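(* Let $\varphi_{\mathbb C}(z)=z+\sqrt{1+z^2}$ and $\varphi_L(z)=\sqrt{1+z}$ for $z\in\mathbb D$ (principal branches of the square roots). Then the sharp $\mathcal S^*(\varphi_L)$-radius of $\mathcal S^*(\varphi_{\mathbb C})$ is $$R_{\mathcal S^*(\varphi_L)}(\mathcal S^*(\varphi_{\mathbb C}))=\frac{\sqrt2}{4}.$$
   Context: Let $\mathbb D=\{z\in\mathbb C:|z|<1\}$ and let $\mathcal A$ be the class of functions $f$ analytic on $\mathbb D$ with $f(0)=0$ and $f'(0)=1$. For an analytic function $\varphi$ on $\mathbb D$ with $\varphi(0)=1$, the class $\mathcal S^*(\varphi)$ consists of all $f\in\mathcal A$ with $zf'(z)/f(z)\prec\varphi(z)$; that is, there is an analytic $\omega:\mathbb D\to\mathbb D$ with $\omega(0)=0$ such that $zf'(z)/f(z)=\varphi(\omega(z))$ on $\mathbb D$ (the quotient takes the value $1$ at $z=0$, and $f$ has no other zeros). For two such functions $\varphi_1,\varphi_2$, the sharp $\mathcal S^*(\varphi_2)$-radius of $\mathcal S^*(\varphi_1)$ is $$R_{\mathcal S^*(\varphi_2)}(\mathcal S^*(\varphi_1))=\sup\left\{r\in(0,1]: f_r(z)=\tfrac{f(rz)}{r}\text{ belongs to }\mathcal S^*(\varphi_2)\text{ for every } f\in\mathcal S^*(\varphi_1)\right\}.$$ *)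

theory Defs
  imports "HOL-Complex_Analysis.Complex_Analysis"
begin

abbreviation unit_disc :: "complex set" where
  "unit_disc \<equiv> ball 0 1"

definition class_A :: "(complex \<Rightarrow> complex) set" where
  "class_A = {f. f holomorphic_on unit_disc \<and> f 0 = 0 \<and> deriv f 0 = 1}"

definition subordinate :: "(complex \<Rightarrow> complex) \<Rightarrow> (complex \<Rightarrow> complex) \<Rightarrow> bool" where
  "subordinate g h \<longleftrightarrow>
     (\<exists>\<omega>. \<omega> holomorphic_on unit_disc \<and> \<omega> ` unit_disc \<subseteq> unit_disc \<and> \<omega> 0 = 0 \<and>
          (\<forall>z\<in>unit_disc. g z = h (\<omega> z)))"

text \<open>The singularity of \<open>z f'(z) / f(z)\<close> at \<open>0\<close> is removed: for \<open>f \<in> class_A\<close> the limit is 1.\<close>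
definition starlike_quotient :: "(complex \<Rightarrow> complex) \<Rightarrow> complex \<Rightarrow> complex" where
  "starlike_quotient f z = (if z = 0 then 1 else z * deriv f z / f z)"

text \<open>
  Meant for \<open>\<phi>\<close> holomorphic on the unit disc with \<open>\<phi> 0 = 1\<close>. The condition that \<open>f\<close> has no zeros
  other than 0 is implicit in the analyticity of the quotient; it is explicit here because
  division by zero is total in HOL.
\<close>
definition starlike_class :: "(complex \<Rightarrow> complex) \<Rightarrow> (complex \<Rightarrow> complex) set" where
  "starlike_class \<phi> =
     {f \<in> class_A. (\<forall>z\<in>unit_disc - {0}. f z \<noteq> 0) \<and> subordinate (starlike_quotient f) \<phi>}"

definition dilation :: "real \<Rightarrow> (complex \<Rightarrow> complex) \<Rightarrow> complex \<Rightarrow> complex" where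
  "dilation r f = (\<lambda>z. f (of_real r * z) / of_real r)"

text \<open>The sharp \<open>starlike_class \<phi>2\<close>-radius of \<open>starlike_class \<phi>1\<close>.\<close>
definition starlike_radius :: "(complex \<Rightarrow> complex) \<Rightarrow> (complex \<Rightarrow> complex) \<Rightarrow> real" where
  "starlike_radius \<phi>2 \<phi>1 =
     Sup {r \<in> {0<..1}. \<forall>f\<in>starlike_class \<phi>1. dilation r f \<in> starlike_class \<phi>2}"

definition phi_crescent :: "complex \<Rightarrow> complex" where
  "phi_crescent z = z + csqrt (1 + z^2)"

definition phi_lemniscate :: "complex \<Rightarrow> complex" where
  "phi_lemniscate z = csqrt (1 + z)"

lemma one_plus_not_nonpos:
  assumes "norm (w::complex) < 1"
  shows "1 + w \<notin> \<real>\<^sub>\<le>\<^sub>0"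
proof -
  have "Re (1 + w) > 0"
    using abs_Re_le_cmod[of w] assms by auto
  then show ?thesis
    by (auto simp: complex_nonpos_Reals_iff)
qed

lemma phi_crescent_admissible:
  "phi_crescent holomorphic_on unit_disc" "phi_crescent 0 = 1"
proof -
  have "1 + z^2 \<notin> \<real>\<^sub>\<le>\<^sub>0" if "z \<in> unit_disc" for z :: complex
    using that by (intro one_plus_not_nonpos) (auto simp: norm_power power_less_one_iff)
  then show "phi_crescent holomorphic_on unit_disc"
    unfolding phi_crescent_def by (intro holomorphic_intros) auto
qed (simp add: phi_crescent_def)

lemma phi_lemniscate_admissible:
  "phi_lemniscate holomorphic_on unit_disc" "phi_lemniscate 0 = 1"
proof -
  show "phi_lemniscate holomorphic_on unit_disc"
    unfolding phi_lemniscate_def by (intro holomorphic_intros) (auto dest: one_plus_not_nonpos)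
qed (simp add: phi_lemniscate_def)

end

theory Submission imports Defs begin

text \<open>
  The value \<open>w = phi_crescent u\<close> satisfies \<open>w\<^sup>2 - 1 = 2 u w\<close>, while the image of
  \<open>phi_lemniscate\<close> is \<open>{w. Re w > 0 \<and> |w\<^sup>2 - 1| < 1}\<close>. For \<open>\<rho> = |u|\<close> this gives
  \<open>|w\<^sup>2 - 1| \<le> 2 \<rho> (\<rho> + sqrt (1 + \<rho>\<^sup>2))\<close>, which is less than \<open>1\<close> for \<open>\<rho> < sqrt 2 / 4\<close>;
  by the Schwarz lemma, dilation by \<open>sqrt 2 / 4\<close> brings \<open>u = \<omega> (r z)\<close> into this range.
  At \<open>u = sqrt 2 / 4\<close> the value \<open>1\<close> is attained, so the function whose starlike quotient is
  \<open>phi_crescent\<close> itself shows sharpness.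
\<close>

text \<open>This supplies the extremal function for sharpness. Integrating f'/f = \<phi>(z)/z gives
  f(z) = z exp(G(z) - G(0)), where G is a primitive of (\<phi>(z) - 1)/z with its singularity at 0
  removed.\<close>

lemma starlike_class_quotient_exists:
  assumes hol: "\<phi> holomorphic_on unit_disc" and one: "\<phi> 0 = 1"
  obtains f where "f \<in> class_A" "\<And>z. z \<in> unit_disc - {0} \<Longrightarrow> f z \<noteq> 0"
    "\<And>z. z \<in> unit_disc \<Longrightarrow> starlike_quotient f z = \<phi> z"
proof -
  define g where "g z = (if z = 0 then deriv \<phi> 0 else (\<phi> z - \<phi> 0) / (z - 0))" for z
  have "g holomorphic_on unit_disc"
    unfolding g_def using hol by (intro pole_lemma) auto
  then obtain G where G: "\<And>z. z \<in> unit_disc \<Longrightarrow> (G has_field_derivative g z) (at z within unit_disc)"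
    using holomorphic_convex_primitive'[of unit_disc g] by auto
  \<comment> \<open>Subtracting \<open>G 0\<close> normalises f'(0) to 1. The logarithmic derivative
    is 1/z + \<open>g z\<close>, so the starlike quotient is 1 + z \<open>g z\<close> =
    \<open>\<phi> z\<close>.\<close>
  define f where "f z = z * exp (G z - G 0)" for z
  have der: "(f has_field_derivative exp (G z - G 0) * (1 + z * g z)) (at z)" if "z \<in> unit_disc" for z
  proof -
    have "(G has_field_derivative g z) (at z)"
      using G[OF that] that by (simp add: at_within_open[of z unit_disc])
    then show ?thesis
      unfolding f_def by (auto intro!: derivative_eq_intros simp: algebra_simps)
  qed
  show ?thesis
  proof
    show "f \<in> class_A"
    proof -
      have "f holomorphic_on unit_disc"
        using der by (subst holomorphic_on_open) (simp, blast)
      then show ?thesis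
        using DERIV_imp_deriv[OF der, of 0] by (simp add: class_A_def) (simp add: f_def)
    qed
    show "f z \<noteq> 0" if "z \<in> unit_disc - {0}" for z
      using that by (simp add: f_def)
    show "starlike_quotient f z = \<phi> z" if "z \<in> unit_disc" for z
      using DERIV_imp_deriv[OF der[OF that]] one
      by (simp add: starlike_quotient_def f_def g_def)
  qed
qed

lemma scale_mem_unit_disc:
  assumes "r \<in> {0<..1}" "z \<in> unit_disc"
  shows "of_real r * z \<in> unit_disc"
proof -
  have "r * norm z \<le> 1 * norm z"
    using assms by (intro mult_right_mono) auto
  then show ?thesis
    using assms by (simp add: norm_mult)
qed

lemma deriv_dilation:
  assumes "f holomorphic_on unit_disc" "r \<in> {0<..1}" "z \<in> unit_disc"
  shows "(dilation r f has_field_derivative deriv f (of_real r * z)) (at z)"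
proof -
  have "(f has_field_derivative deriv f (of_real r * z)) (at (of_real r * z))"
    using assms scale_mem_unit_disc by (intro holomorphic_derivI[of _ unit_disc]) auto
  then have "((\<lambda>z. f (of_real r * z)) has_field_derivative deriv f (of_real r * z) * of_real r) (at z)"
    by (rule DERIV_chain2) (auto intro!: derivative_eq_intros)
  from DERIV_cdivide[OF this, of "of_real r"] show ?thesis
    using assms unfolding dilation_def by simp
qed

lemma dilation_class_A:
  assumes "f \<in> class_A" "r \<in> {0<..1}"
  shows "dilation r f \<in> class_A"
proof -
  have f: "f holomorphic_on unit_disc" "f 0 = 0" "deriv f 0 = 1"
    using assms by (auto simp: class_A_def)
  then have "dilation r f holomorphic_on unit_disc"
    using deriv_dilation[OF f(1) assms(2)] by (subst holomorphic_on_open) (simp, blast)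
  then show ?thesis
    using f DERIV_imp_deriv[OF deriv_dilation[OF f(1) assms(2), of 0]]
    by (simp add: class_A_def) (simp add: dilation_def)
qed

lemma starlike_quotient_dilation:
  assumes "f \<in> class_A" "r \<in> {0<..1}" "z \<in> unit_disc"
  shows "starlike_quotient (dilation r f) z = starlike_quotient f (of_real r * z)"
  using assms DERIV_imp_deriv[OF deriv_dilation[of f r z]]
  by (auto simp: class_A_def starlike_quotient_def) (simp add: dilation_def mult_ac)

lemma phi_crescent_square: "(phi_crescent u)\<^sup>2 - 1 = 2 * u * phi_crescent u"
proof -
  have "(csqrt (1 + u\<^sup>2))\<^sup>2 = 1 + u\<^sup>2" by simp
  then show ?thesis
    unfolding phi_crescent_def by algebra
qed

text \<open>On the right half-plane the principal root inverts squaring, so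
  \<open>w\<^sup>2 - 1\<close> is a preimage of w.\<close>

lemma phi_lemniscate_square_minus_one: "0 < Re w \<Longrightarrow> phi_lemniscate (w\<^sup>2 - 1) = w"
  by (simp add: phi_lemniscate_def csqrt_square)

text \<open>The bound on \<open>|w\<^sup>2 - 1|\<close> alone would also allow the left loop of the
  lemniscate; this excludes it. With s the root, (s - 1)(s + 1) = \<open>u\<^sup>2\<close> and |s +
  1| \<ge> 1 keep s within 1/8 of 1, while u is too small to move the sum out of the
  half-plane.\<close>

lemma Re_phi_crescent_pos:
  assumes "norm u < sqrt 2 / 4"
  shows "0 < Re (phi_crescent u)"
proof -
  define s where "s = csqrt (1 + u\<^sup>2)"
  have u2: "(norm u)\<^sup>2 < 1 / 8"
    using power_strict_mono[OF assms, of 2] by (simp add: power_divide)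
  have "0 \<le> Re s"
    using csqrt_principal[of "1 + u\<^sup>2"] by (auto simp: s_def)
  then have "1 \<le> norm (s + 1)"
    using complex_Re_le_cmod[of "s + 1"] by simp
  moreover have "(s - 1) * (s + 1) = u\<^sup>2"
    using power2_csqrt[of "1 + u\<^sup>2"] by (simp add: s_def algebra_simps power2_eq_square)
  then have "norm (s - 1) * norm (s + 1) = (norm u)\<^sup>2"
    by (metis norm_mult norm_power)
  ultimately have "norm (s - 1) < 1 / 8"
    using u2 mult_left_mono[of 1 "norm (s + 1)" "norm (s - 1)"] by auto
  then have "Re s > 7 / 8"
    using abs_Re_le_cmod[of "s - 1"] by auto
  moreover have "\<bar>Re u\<bar> < 1 / 2"
    using abs_Re_le_cmod[of u] assms sqrt2_less_2 by linarith
  ultimately show ?thesis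
    by (simp add: phi_crescent_def flip: s_def)
qed

lemma norm_phi_crescent_square_less:
  assumes "norm u < sqrt 2 / 4"
  shows "norm ((phi_crescent u)\<^sup>2 - 1) < 1"
proof -
  have u2: "(norm u)\<^sup>2 < 1 / 8"
    using power_strict_mono[OF assms, of 2] by (simp add: power_divide)
  have "norm (csqrt (1 + u\<^sup>2)) = sqrt (norm (1 + u\<^sup>2))"
    by (rule norm_csqrt)
  also have "norm (1 + u\<^sup>2) \<le> 1 + (norm u)\<^sup>2"
    using norm_triangle_ineq[of 1 "u\<^sup>2"] by (simp add: norm_power)
  \<comment> \<open>The radicand is at most 1 + 1/8 = 9/8, the square of 3 sqrt 2 / 4. Adding |u| <
    sqrt 2 / 4 then gives the bound sqrt 2.\<close>
  then have "sqrt (norm (1 + u\<^sup>2)) \<le> 3 * sqrt 2 / 4"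
    using u2 by (intro real_le_lsqrt) (auto simp: power_divide power_mult_distrib)
  finally have "norm (phi_crescent u) \<le> sqrt 2"
    using norm_triangle_ineq[of u "csqrt (1 + u\<^sup>2)"] assms
    unfolding phi_crescent_def by linarith
  then have "norm (2 * u * phi_crescent u) \<le> 2 * norm u * sqrt 2"
    by (simp add: norm_mult mult_left_mono)
  also have "\<dots> < 2 * (sqrt 2 / 4) * sqrt 2"
    using assms by (intro mult_strict_right_mono) auto
  finally show ?thesis
    by (simp add: phi_crescent_square)
qed

text \<open>Equality case of the preceding estimate: 1 + 1/8 = 9/8 has root 3 sqrt 2 / 4. The value
  sqrt 2 is the boundary point of the lemniscate where \<open>w\<^sup>2 - 1\<close> equals
  1.\<close>

lemma phi_crescent_sharp: "phi_crescent (of_real (sqrt 2 / 4)) = of_real (sqrt 2)"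
proof -
  have "1 + (complex_of_real (sqrt 2 / 4))\<^sup>2 = of_real (1 + (sqrt 2 / 4)\<^sup>2)"
    by simp
  also have "1 + (sqrt 2 / 4)\<^sup>2 = (3 * sqrt 2 / 4)\<^sup>2"
    by (simp add: power_divide power_mult_distrib)
  finally have "csqrt (1 + (complex_of_real (sqrt 2 / 4))\<^sup>2) = of_real (3 * sqrt 2 / 4)"
    by (simp only: of_real_power) (simp add: csqrt_square)
  then show ?thesis
    unfolding phi_crescent_def by (simp only:) (simp flip: of_real_add)
qed

lemma dilation_crescent_lemniscate:
  assumes f: "f \<in> starlike_class phi_crescent"
  shows "dilation (sqrt 2 / 4) f \<in> starlike_class phi_lemniscate"
proof -
  define r where "r = sqrt 2 / 4"
  have r: "r \<in> {0<..1}"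
    using sqrt2_less_2 by (simp add: r_def)
  have fA: "f \<in> class_A" and f0: "\<And>z. z \<in> unit_disc - {0} \<Longrightarrow> f z \<noteq> 0"
    and "subordinate (starlike_quotient f) phi_crescent"
    using f by (auto simp: starlike_class_def)
  then obtain \<omega> where \<omega>: "\<omega> holomorphic_on unit_disc" "\<omega> ` unit_disc \<subseteq> unit_disc" "\<omega> 0 = 0"
    and quot: "\<And>z. z \<in> unit_disc \<Longrightarrow> starlike_quotient f z = phi_crescent (\<omega> z)"
    by (auto simp: subordinate_def)
  have less: "norm (\<omega> (of_real r * z)) < sqrt 2 / 4" if "z \<in> unit_disc" for z
  proof -
    have "norm (\<omega> (of_real r * z)) \<le> norm (of_real r * z)"
      using \<omega> scale_mem_unit_disc[OF r that]
      by (intro Schwarz_Lemma(1)) (auto simp: image_subset_iff)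
    also have "\<dots> < r"
      using r that by (simp add: norm_mult)
    finally show ?thesis by (simp add: r_def)
  qed
  \<comment> \<open>The choice is forced: \<open>phi_lemniscate v = w\<close> implies v =
    \<open>w\<^sup>2 - 1\<close>.\<close>
  define \<omega>' where "\<omega>' z = (phi_crescent (\<omega> (of_real r * z)))\<^sup>2 - 1" for z
  have "(\<lambda>z. phi_crescent (\<omega> (of_real r * z))) holomorphic_on unit_disc"
  proof -
    have "(\<omega> \<circ> (\<lambda>z. of_real r * z)) holomorphic_on unit_disc"
      using scale_mem_unit_disc[OF r]
      by (intro holomorphic_on_compose_gen[OF _ \<omega>(1)] holomorphic_intros) auto
    from holomorphic_on_compose_gen[OF this phi_crescent_admissible(1)] show ?thesis
      using \<omega>(2) scale_mem_unit_disc[OF r] by (force simp: o_def)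
  qed
  then have "\<omega>' holomorphic_on unit_disc"
    unfolding \<omega>'_def by (intro holomorphic_intros)
  moreover have "\<omega>' ` unit_disc \<subseteq> unit_disc"
    using norm_phi_crescent_square_less[OF less] by (auto simp: \<omega>'_def)
  moreover have "\<omega>' 0 = 0"
    by (simp add: \<omega>'_def \<omega> phi_crescent_admissible)
  moreover have "starlike_quotient (dilation r f) z = phi_lemniscate (\<omega>' z)" if "z \<in> unit_disc" for z
    using that fA r less[OF that] scale_mem_unit_disc[OF r that]
    by (simp add: starlike_quotient_dilation quot \<omega>'_def phi_lemniscate_square_minus_one
        Re_phi_crescent_pos)
  ultimately have "subordinate (starlike_quotient (dilation r f)) phi_lemniscate"
    unfolding subordinate_def by blast
  moreover have "dilation r f z \<noteq> 0" if "z \<in> unit_disc - {0}" for z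
    using f0[of "of_real r * z"] scale_mem_unit_disc[OF r, of z] that r by (auto simp: dilation_def)
  ultimately have "dilation r f \<in> starlike_class phi_lemniscate"
    using dilation_class_A[OF fA r] by (simp add: starlike_class_def)
  then show ?thesis by (simp add: r_def)
qed

theorem theorem7p11:
  "starlike_radius phi_lemniscate phi_crescent = sqrt 2 / 4"
  unfolding starlike_radius_def
proof (rule cSup_eq_maximum)
  show "sqrt 2 / 4 \<in> {r \<in> {0<..1}. \<forall>f\<in>starlike_class phi_crescent.
      dilation r f \<in> starlike_class phi_lemniscate}"
    using dilation_crescent_lemniscate sqrt2_less_2 by auto
next
  fix r assume "r \<in> {r \<in> {0<..1}. \<forall>f\<in>starlike_class phi_crescent.
      dilation r f \<in> starlike_class phi_lemniscate}"
  then have r: "r \<in> {0<..1}"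
    and dil: "\<And>f. f \<in> starlike_class phi_crescent \<Longrightarrow> dilation r f \<in> starlike_class phi_lemniscate"
    by auto
  show "r \<le> sqrt 2 / 4"
  proof (rule ccontr)
    assume "\<not> r \<le> sqrt 2 / 4"
    then have r': "sqrt 2 / 4 < r" by simp
    obtain f where f: "f \<in> class_A" "\<And>z. z \<in> unit_disc - {0} \<Longrightarrow> f z \<noteq> 0"
      and quot: "\<And>z. z \<in> unit_disc \<Longrightarrow> starlike_quotient f z = phi_crescent z"
      using starlike_class_quotient_exists[OF phi_crescent_admissible] by blast
    \<comment> \<open>The identity serves as Schwarz function, so the quotient takes every value of
      \<open>phi_crescent\<close>.\<close>
    have "subordinate (starlike_quotient f) phi_crescent"
      unfolding subordinate_def using quot by (intro exI[of _ "\<lambda>z. z"]) auto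
    with f have "dilation r f \<in> starlike_class phi_lemniscate"
      by (intro dil) (simp add: starlike_class_def)
    then obtain \<omega> where \<omega>: "\<omega> ` unit_disc \<subseteq> unit_disc"
      and quot': "\<And>z. z \<in> unit_disc \<Longrightarrow> starlike_quotient (dilation r f) z = phi_lemniscate (\<omega> z)"
      by (auto simp: starlike_class_def subordinate_def)
    \<comment> \<open>Chosen so that r z = sqrt 2 / 4; the point lies in the disc because r exceeds
      sqrt 2 / 4. Squaring the value there forces \<omega>(z) = 1, on the unit circle.\<close>
    define z where "z = complex_of_real (sqrt 2 / 4 / r)"
    have z: "z \<in> unit_disc"
      using r r' unfolding z_def by (simp add: norm_divide norm_mult)
    have rz: "of_real r * z = of_real (sqrt 2 / 4)"
      using r by (simp add: z_def)
    have "phi_lemniscate (\<omega> z) = of_real (sqrt 2)"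
      using starlike_quotient_dilation[OF f(1) r z] quot'[OF z] quot[of "of_real r * z"]
        scale_mem_unit_disc[OF r z] phi_crescent_sharp by (simp only: rz)
    then have "1 + \<omega> z = (of_real (sqrt 2))\<^sup>2"
      unfolding phi_lemniscate_def by (metis power2_csqrt)
    also have "\<dots> = 2"
      by (simp flip: of_real_power)
    finally have "\<omega> z = 1" by (simp add: algebra_simps)
    moreover have "norm (\<omega> z) < 1"
      using \<omega> z by (auto simp: image_subset_iff)
    ultimately show False by simp
  qed
qed

end
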